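(* Let $p$ and $q$ be distinct prime numbers. Let $\mathbf{Clo}^{\mathcal{L}}(\langle \mathbb{Z}_{pq},+\rangle)$ be the lattice of all clones on $\mathbb{Z}_{pq}$ containing $\mathrm{Clo}(\langle \mathbb{Z}_{pq},+\rangle)$, let $\mathcal{L}(\mathbb{Z}_p,\mathbb{Z}_q)$ be the lattice of all $(\mathbb{Z}_p,\mathbb{Z}_q)$-linearly closed clonoids and let $\mathcal{L}(\mathbb{Z}_q,\mathbb{Z}_p)$ be the lattice of all $(\mathbb{Z}_q,\mathbb{Z}_p)$-linearly closed clonoids. Then there is an injective function $$\mathbf{Clo}^{\mathcal{L}}(\langle \mathbb{Z}_{pq},+\rangle)\hookrightarrow \mathcal{L}(\mathbb{Z}_p,\mathbb{Z}_q)^{p+1}\times\mathcal{L}(\mathbb{Z}_q,\mathbb{Z}_p)^{q+1}.$$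
   Context: $\mathbb{N}$ is the set of positive integers. A clone on a set $A$ is a set of finitary operations on $A$ containing all projections and closed under composition. $\mathrm{Clo}(\langle \mathbb{Z}_{pq},+\rangle)$ is the clone on $\mathbb{Z}_{pq}$ generated by the addition. For distinct primes $u,v$ and a set $C\subseteq \bigcup_{n\in\mathbb{N}}\mathbb{Z}_u^{\mathbb{Z}_v^n}$ let $C^{[n]}$ be the set of $n$-ary members of $C$. A $(\mathbb{Z}_u,\mathbb{Z}_v)$-linearly closed clonoid is a non-empty subset $C$ of $\bigcup_{n\in\mathbb{N}}\mathbb{Z}_u^{\mathbb{Z}_v^n}$ such that: (1) for all $n\in\mathbb{N}$, $f,g\in C^{[n]}$ and $a,b\in\mathbb{Z}_u$: $af+bg\in C^{[n]}$; (2) for all $m,n\in\mathbb{N}$, $f\in C^{[m]}$ and $A\in\mathbb{Z}_v^{m\times n}$, the function $(x_1,\dots,x_n)\mapsto f(A\cdot(x_1,\dots,x_n)^t)$ is in $C^{[n]}$. These clonoids form a lattice under inclusion. *)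

theory Defs
  imports "HOL-Number_Theory.Residues" "HOL-Library.FuncSet"
begin

text \<open>
  An n-tuple over A is a list of length n with entries in A.  An n-ary function from A to B is an
  extensional function on n-tuples (it is undefined elsewhere), stored together with its
  arity n.  The arity is kept explicitly because an extensional function on lists does not
  determine it when all its values are undefined.
\<close>

definition tuples :: "nat \<Rightarrow> 'a set \<Rightarrow> 'a list set" where
  "tuples n A = {xs. length xs = n \<and> set xs \<subseteq> A}"

definition finitary_functions :: "'a set \<Rightarrow> 'b set \<Rightarrow> (nat \<times> ('a list \<Rightarrow> 'b)) set" where
  "finitary_functions A B = (SIGMA n:{1..}. tuples n A \<rightarrow>\<^sub>E B)"

definition arity_part :: "(nat \<times> ('a list \<Rightarrow> 'b)) set \<Rightarrow> nat \<Rightarrow> ('a list \<Rightarrow> 'b) set" where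
  "arity_part C n = {f. (n, f) \<in> C}"

definition projection :: "'a set \<Rightarrow> nat \<Rightarrow> nat \<Rightarrow> ('a list \<Rightarrow> 'a)" where
  "projection A n i = (\<lambda>xs\<in>tuples n A. xs ! i)"

definition compose_ops :: "'a set \<Rightarrow> nat \<Rightarrow> ('a list \<Rightarrow> 'a) \<Rightarrow> ('a list \<Rightarrow> 'a) list \<Rightarrow> ('a list \<Rightarrow> 'a)" where
  "compose_ops A n f gs = (\<lambda>xs\<in>tuples n A. f (map (\<lambda>g. g xs) gs))"

definition is_clone :: "'a set \<Rightarrow> (nat \<times> ('a list \<Rightarrow> 'a)) set \<Rightarrow> bool" where
  "is_clone A C \<longleftrightarrow>
     C \<subseteq> finitary_functions A A \<and>
     (\<forall>n\<ge>1. \<forall>i<n. projection A n i \<in> arity_part C n) \<and>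
     (\<forall>m\<ge>1. \<forall>n\<ge>1. \<forall>f\<in>arity_part C m. \<forall>gs.
        length gs = m \<and> set gs \<subseteq> arity_part C n \<longrightarrow> compose_ops A n f gs \<in> arity_part C n)"

definition clone_generated_by ::
  "'a set \<Rightarrow> (nat \<times> ('a list \<Rightarrow> 'a)) set \<Rightarrow> (nat \<times> ('a list \<Rightarrow> 'a)) set" where
  "clone_generated_by A F = \<Inter>{C. is_clone A C \<and> F \<subseteq> C}"

abbreviation \<Z> :: "nat \<Rightarrow> int ring" where
  "\<Z> n \<equiv> residue_ring (int n)"

definition addition_op :: "nat \<Rightarrow> nat \<times> (int list \<Rightarrow> int)" where
  "addition_op n = (2, \<lambda>xs\<in>tuples 2 (carrier (\<Z> n)). xs ! 0 \<oplus>\<^bsub>\<Z> n\<^esub> xs ! 1)"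

definition Clo_add :: "nat \<Rightarrow> (nat \<times> (int list \<Rightarrow> int)) set" where
  "Clo_add n = clone_generated_by (carrier (\<Z> n)) {addition_op n}"

definition clones_above_add :: "nat \<Rightarrow> (nat \<times> (int list \<Rightarrow> int)) set set" where
  "clones_above_add n = {C. is_clone (carrier (\<Z> n)) C \<and> Clo_add n \<subseteq> C}"

text \<open>
  An m by n matrix over S is a function of a row index i < m and a column index j < n; its other
  values are irrelevant.
\<close>

definition mat_vec :: "'b ring \<Rightarrow> nat \<Rightarrow> nat \<Rightarrow> (nat \<Rightarrow> nat \<Rightarrow> 'b) \<Rightarrow> 'b list \<Rightarrow> 'b list" where
  "mat_vec S m n M xs = map (\<lambda>i. \<Oplus>\<^bsub>S\<^esub>j\<in>{..<n}. M i j \<otimes>\<^bsub>S\<^esub> xs ! j) [0..<m]"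

definition linearly_closed_clonoid ::
  "'a ring \<Rightarrow> 'b ring \<Rightarrow> (nat \<times> ('b list \<Rightarrow> 'a)) set \<Rightarrow> bool" where
  "linearly_closed_clonoid R S C \<longleftrightarrow>
     C \<noteq> {} \<and> C \<subseteq> finitary_functions (carrier S) (carrier R) \<and>
     (\<forall>n\<ge>1. \<forall>f\<in>arity_part C n. \<forall>g\<in>arity_part C n. \<forall>a\<in>carrier R. \<forall>b\<in>carrier R.
        (\<lambda>xs\<in>tuples n (carrier S). a \<otimes>\<^bsub>R\<^esub> f xs \<oplus>\<^bsub>R\<^esub> b \<otimes>\<^bsub>R\<^esub> g xs) \<in> arity_part C n) \<and>
     (\<forall>m\<ge>1. \<forall>n\<ge>1. \<forall>f\<in>arity_part C m. \<forall>M.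
        (\<forall>i<m. \<forall>j<n. M i j \<in> carrier S) \<longrightarrow>
        (\<lambda>xs\<in>tuples n (carrier S). f (mat_vec S m n M xs)) \<in> arity_part C n)"

definition clonoids :: "nat \<Rightarrow> nat \<Rightarrow> (nat \<times> (int list \<Rightarrow> int)) set set" where
  "clonoids u v = {C. linearly_closed_clonoid (\<Z> u) (\<Z> v) C}"

end

theory Submission
  imports Defs
begin

text \<open>
  Let \<open>C\<close> be a clone on \<open>\<int>/pq\<close> that contains the addition.  Multiplication by an integer constant is
  a repeated addition, so \<open>C\<close> contains the multiplications by the two idempotents \<open>e \<equiv> 1 (mod p)\<close>,
  \<open>e \<equiv> 0 (mod q)\<close> and \<open>e' = 1 - e\<close>.  Since \<open>f = e f + e' f\<close>, the clone is determined by its members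
  with values in \<open>e \<int>/pq\<close>, a copy of \<open>\<int>/p\<close>, and those with values in \<open>e' \<int>/pq\<close>, a copy of
  \<open>\<int>/q\<close>.  The two cases are symmetric; consider the first.

  Substituting \<open>e x + e' y\<close> for each variable turns a member with values in \<open>\<int>/p\<close> into a function
  of variables \<open>x\<close> over \<open>\<int>/p\<close> and variables \<open>y\<close> over \<open>\<int>/q\<close>.  It is a polynomial in the \<open>x\<close>
  whose coefficients are functions of the \<open>y\<close>.  The \<open>d\<close>-th slice of \<open>C\<close> consists of the functions
  \<open>f : (\<int>/q)^n \<rightarrow> \<int>/p\<close> for which \<open>x_0 \<cdots> x_(d-1) f(y)\<close> belongs to \<open>C\<close>.  Each slice is a linearly
  closed clonoid (\<open>slice_clonoid\<close>), and the injection sends \<open>C\<close> to its slices \<open>0, \<dots>, p\<close> over \<open>p\<close> and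
  \<open>0, \<dots>, q\<close> over \<open>q\<close>.  It is injective for two reasons.

  All slices together determine the \<open>\<int>/p\<close>-valued part (\<open>prime_part_subset\<close>).  Every function is a
  polynomial of degree at most \<open>p - 1\<close> in each \<open>x\<close>.  Iterated differences in one variable send a
  polynomial of degree \<open>J\<close> to \<open>J! u_1 \<cdots> u_J\<close> times its leading coefficient, and \<open>J!\<close> is invertible
  because \<open>J < p\<close> (\<open>polarization\<close>).  This removes one variable from the coefficient at the price of
  \<open>J\<close> new linear factors; setting \<open>u_1, \<dots>, u_J\<close> equal to the variable recovers the leading monomial,
  which may then be subtracted.

  The slices beyond the \<open>p\<close>-th repeat earlier ones: for \<open>d \<ge> 2\<close> the slices \<open>d\<close> and \<open>d + (p - 1)\<close>
  coincide.  One inclusion is the identification of variables together with \<open>x^p = x\<close>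
  (\<open>slice_reduce\<close>).  For the other, substitute the function \<open>x_0 \<cdots> x_(d-1) f(y)\<close> for its own variable
  \<open>x_0\<close>; each repetition raises the number of factors by \<open>d - 1 \<ge> 1\<close> and the exponent of \<open>f\<close> by 1, and
  \<open>f^p = f\<close> (\<open>slice_raise\<close>).  The argument breaks down at \<open>d = 1\<close>, which is why the slices \<open>1\<close> and
  \<open>p\<close> are both recorded.
\<close>

section \<open>Functions represented by a clone\<close>

lemma carrier_residue_ring: "carrier (residue_ring m) = {0..<m}"
  by (auto simp: residue_ring_def)

lemma add_residue_ring: "x \<oplus>\<^bsub>residue_ring m\<^esub> y = (x + y) mod m"
  by (simp add: residue_ring_def)

lemma mult_residue_ring: "x \<otimes>\<^bsub>residue_ring m\<^esub> y = (x * y) mod m"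
  by (simp add: residue_ring_def)

text \<open>
  The members of a clone, freed from their arities: functions of integer variables indexed by an
  arbitrary type, taken modulo \<open>N\<close>, that are given by a member of \<open>C\<close> on some list of variables.
  Substitution, addition and renaming then need no bookkeeping of positions, and different kinds of
  variables can be kept apart by their index type.
\<close>

definition clone_functions :: "nat \<Rightarrow> (nat \<times> (int list \<Rightarrow> int)) set \<Rightarrow> (('v \<Rightarrow> int) \<Rightarrow> int) set" where
  "clone_functions N C = {F. \<exists>vs f. vs \<noteq> [] \<and> (length vs, f) \<in> C \<and>
     (\<forall>\<sigma>. [F \<sigma> = f (map (\<lambda>v. \<sigma> v mod int N) vs)] (mod int N))}"

locale clone_above_addition =
  fixes N :: nat and C :: "(nat \<times> (int list \<Rightarrow> int)) set"
  assumes N_gt_1: "N > 1" and above: "C \<in> clones_above_add N"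
begin

abbreviation "A \<equiv> carrier (\<Z> N)"

lemma clone: "is_clone A C"
  using above by (simp add: clones_above_add_def)

lemma addition_in_C: "addition_op N \<in> C"
  using above by (auto simp: clones_above_add_def Clo_add_def clone_generated_by_def)

lemma mod_in_A: "x mod int N \<in> A"
  using N_gt_1 by (simp add: carrier_residue_ring)

lemma map_mod_in_tuples: "map (\<lambda>v. \<sigma> v mod int N) vs \<in> tuples (length vs) A"
  using mod_in_A by (auto simp: tuples_def)

lemma operation_in_A:
  assumes "(n, f) \<in> C" "xs \<in> tuples n A"
  shows "f xs \<in> A"
  using assms clone by (auto simp: is_clone_def finitary_functions_def)

lemma operation_mod:
  assumes "(n, f) \<in> C" "xs \<in> tuples n A"
  shows "f xs mod int N = f xs"
  using operation_in_A[OF assms] by (simp add: carrier_residue_ring)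

lemma compose_in_C:
  assumes "(length gs, f) \<in> C" "gs \<noteq> []" "n \<ge> 1" "\<And>g. g \<in> set gs \<Longrightarrow> (n, g) \<in> C"
  shows "(n, compose_ops A n f gs) \<in> C"
proof -
  have "length gs \<ge> 1" using assms(2) by (simp add: Suc_leI)
  then show ?thesis
    using clone assms unfolding is_clone_def arity_part_def by blast
qed

lemma projection_in_C: "i < n \<Longrightarrow> (n, projection A n i) \<in> C"
  using clone unfolding is_clone_def arity_part_def by (cases n) auto

lemma clone_functions_cong:
  assumes "F \<in> clone_functions N C" "\<And>\<sigma>. [G \<sigma> = F \<sigma>] (mod int N)"
  shows "G \<in> clone_functions N C"
  using assms unfolding clone_functions_def by (blast intro: cong_trans)

lemma operation_in_clone_functions:
  assumes "(n, f) \<in> C" "length vs = n"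
  shows "(\<lambda>\<sigma>. f (map (\<lambda>v. \<sigma> v mod int N) vs)) \<in> clone_functions N C"
proof -
  have "vs \<noteq> []"
    using assms clone by (auto simp: is_clone_def finitary_functions_def)
  then show ?thesis
    using assms unfolding clone_functions_def mem_Collect_eq by (intro exI[of _ vs] exI[of _ f]) simp
qed

lemma variable_in_clone_functions: "(\<lambda>\<sigma>. \<sigma> v) \<in> clone_functions N C"
proof -
  have "(1, projection A 1 0) \<in> C" by (rule projection_in_C) simp
  then have "(\<lambda>\<sigma>. projection A 1 0 (map (\<lambda>v. \<sigma> v mod int N) [v])) \<in> clone_functions N C"
    by (rule operation_in_clone_functions) simp
  then show ?thesis
    by (rule clone_functions_cong) (use mod_in_A in \<open>simp add: projection_def tuples_def cong_def\<close>)
qed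

text \<open>The operations substituted for the variables need not share their arity; composing them with
  projections turns all of them into operations on the concatenation of their variable lists.\<close>

lemma clone_functions_subst:
  assumes F: "F \<in> clone_functions N C" and S: "\<And>v. S v \<in> clone_functions N C"
  shows "(\<lambda>\<sigma>. F (\<lambda>v. S v \<sigma>)) \<in> clone_functions N C"
proof -
  obtain vs f where vs: "vs \<noteq> []" "(length vs, f) \<in> C"
      and Ff: "\<And>\<sigma>. [F \<sigma> = f (map (\<lambda>v. \<sigma> v mod int N) vs)] (mod int N)"
    using F unfolding clone_functions_def by blast
  obtain ws g where ws: "\<And>v. ws v \<noteq> []" "\<And>v. (length (ws v), g v) \<in> C"
      and Sg: "\<And>v \<sigma>. [S v \<sigma> = g v (map (\<lambda>v. \<sigma> v mod int N) (ws v))] (mod int N)"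
    using S unfolding clone_functions_def mem_Collect_eq by metis
  define W where "W = concat (map ws vs)"
  define n where "n = length W"
  have W: "w \<in> set W" if "v \<in> set vs" "w \<in> set (ws v)" for v w
    using that by (auto simp: W_def)
  have n: "n \<ge> 1"
    using vs(1) ws(1) by (cases vs) (auto simp: n_def W_def Suc_le_eq)
  define pos where "pos w = (SOME i. i < n \<and> W ! i = w)" for w
  have pos: "pos w < n \<and> W ! pos w = w" if "w \<in> set W" for w
    using that unfolding pos_def by (rule_tac someI_ex) (auto simp: in_set_conv_nth n_def)
  define h where "h v = compose_ops A n (g v) (map (\<lambda>w. projection A n (pos w)) (ws v))" for v
  have hC: "(n, h v) \<in> C" if "v \<in> set vs" for v
    unfolding h_def
    by (rule compose_in_C) (use ws n W[OF that] pos projection_in_C in auto)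
  have tup: "map (\<lambda>v. \<sigma> v mod int N) W \<in> tuples n A" for \<sigma>
    using map_mod_in_tuples by (simp add: n_def)
  have h: "h v (map (\<lambda>w. \<sigma> w mod int N) W) = S v \<sigma> mod int N" if v: "v \<in> set vs" for v \<sigma>
  proof -
    have "map (\<lambda>u. u (map (\<lambda>w. \<sigma> w mod int N) W)) (map (\<lambda>w. projection A n (pos w)) (ws v))
        = map (\<lambda>w. \<sigma> w mod int N) (ws v)"
      using tup[of \<sigma>] W[OF v] pos by (auto simp: projection_def n_def)
    then have "h v (map (\<lambda>w. \<sigma> w mod int N) W) = g v (map (\<lambda>w. \<sigma> w mod int N) (ws v))"
      using tup[of \<sigma>] by (simp add: h_def compose_ops_def del: map_map)
    also have "\<dots> = S v \<sigma> mod int N"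
      using Sg[of v \<sigma>] operation_mod[OF ws(2) map_mod_in_tuples] by (simp add: cong_def)
    finally show ?thesis .
  qed
  have "(n, compose_ops A n f (map h vs)) \<in> C"
    by (rule compose_in_C) (use vs n hC in auto)
  then have "(\<lambda>\<sigma>. compose_ops A n f (map h vs) (map (\<lambda>w. \<sigma> w mod int N) W)) \<in> clone_functions N C"
    by (rule operation_in_clone_functions) (simp add: n_def)
  then show ?thesis
  proof (rule clone_functions_cong)
    fix \<sigma>
    have "map (\<lambda>u. u (map (\<lambda>w. \<sigma> w mod int N) W)) (map h vs) = map (\<lambda>v. S v \<sigma> mod int N) vs"
      using h by simp
    then have "compose_ops A n f (map h vs) (map (\<lambda>w. \<sigma> w mod int N) W)
        = f (map (\<lambda>v. S v \<sigma> mod int N) vs)"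
      using tup[of \<sigma>] by (simp add: compose_ops_def del: map_map)
    then show "[F (\<lambda>v. S v \<sigma>) = compose_ops A n f (map h vs) (map (\<lambda>w. \<sigma> w mod int N) W)] (mod int N)"
      using Ff by simp
  qed
qed

lemma clone_functions_add:
  assumes "F \<in> clone_functions N C" "G \<in> clone_functions N C"
  shows "(\<lambda>\<sigma>. F \<sigma> + G \<sigma>) \<in> clone_functions N C"
proof -
  obtain a where a: "addition_op N = (2, a)" by (simp add: addition_op_def)
  have "(\<lambda>\<sigma>. a (map (\<lambda>v. \<sigma> v mod int N) [True, False])) \<in> clone_functions N C"
    using addition_in_C a by (intro operation_in_clone_functions[of 2]) auto
  then have "(\<lambda>\<sigma>. \<sigma> True + \<sigma> False) \<in> clone_functions N C"
    by (rule clone_functions_cong)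
      (use a mod_in_A in \<open>auto simp: addition_op_def tuples_def add_residue_ring cong_def mod_add_eq\<close>)
  from clone_functions_subst[OF this, of "\<lambda>b. if b then F else G"] assms
  show ?thesis by simp
qed

lemma clone_functions_scale:
  assumes "F \<in> clone_functions N C"
  shows "(\<lambda>\<sigma>. c * F \<sigma>) \<in> clone_functions N C"
proof -
  \<comment> \<open>A residue is represented by a positive multiplier, since only non-empty sums are available.\<close>
  have pos: "(\<lambda>\<sigma>. int (Suc k) * F \<sigma>) \<in> clone_functions N C" for k
  proof (induction k)
    case (Suc k)
    from clone_functions_add[OF this assms] show ?case by (simp add: algebra_simps)
  qed (use assms in simp)
  define k where "k = nat (c mod int N) + N - 1"
  have "int (Suc k) = c mod int N + int N" using N_gt_1 by (simp add: k_def)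
  then have "[c = int (Suc k)] (mod int N)" by (simp add: cong_def)
  with pos[of k] show ?thesis
    by (elim clone_functions_cong) (simp add: cong_scalar_right)
qed

lemma clone_functions_sum:
  assumes "\<And>i. i \<in> I \<Longrightarrow> F i \<in> clone_functions N C"
  shows "(\<lambda>\<sigma>. \<Sum>i\<in>I. F i \<sigma>) \<in> clone_functions N C"
proof -
  have zero: "(\<lambda>\<sigma>. 0) \<in> clone_functions N C"
    using clone_functions_scale[OF variable_in_clone_functions, of 0] by simp
  show ?thesis
    using assms by (induction I rule: infinite_finite_induct) (auto simp: zero clone_functions_add)
qed

text \<open>
  Passing to \<open>clone_functions\<close> loses nothing: variables that do not occur among the \<open>n\<close> arguments are
  redirected to the first argument, which exists because arities are positive.
\<close>

lemma operation_in_C: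
  assumes f: "f \<in> tuples n A \<rightarrow>\<^sub>E A" and n: "n \<ge> 1"
    and F: "(\<lambda>\<sigma>. f (map (\<lambda>i. \<sigma> i mod int N) [0..<n])) \<in> clone_functions N C"
  shows "(n, f) \<in> C"
proof -
  obtain vs h where vs: "vs \<noteq> []" "(length vs, h) \<in> C"
      and h: "\<And>\<sigma>. [f (map (\<lambda>i. \<sigma> i mod int N) [0..<n]) = h (map (\<lambda>v. \<sigma> v mod int N) vs)] (mod int N)"
    using F unfolding clone_functions_def by blast
  define pr where "pr i = (if i < n then i else 0)" for i :: nat
  have pr: "pr i < n" for i using n by (simp add: pr_def)
  define H where "H = compose_ops A n h (map (\<lambda>v. projection A n (pr v)) vs)"
  have "f = H"
  proof (rule ext)
    fix xs
    show "f xs = H xs"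
    proof (cases "xs \<in> tuples n A")
      case True
      define \<sigma> where "\<sigma> v = xs ! pr v" for v
      have \<sigma>: "\<sigma> v mod int N = xs ! pr v" for v
        using True pr[of v] nth_mem[of "pr v" xs]
        by (auto simp: tuples_def carrier_residue_ring \<sigma>_def subset_iff)
      have xs: "xs = map (\<lambda>i. \<sigma> i mod int N) [0..<n]"
        unfolding \<sigma> using True by (intro nth_equalityI) (auto simp: tuples_def pr_def)
      have "H xs = h (map (\<lambda>v. \<sigma> v mod int N) vs)"
        using True by (simp add: H_def compose_ops_def \<sigma> projection_def comp_def)
      moreover have "f xs mod int N = f xs"
        using f True by (auto simp: carrier_residue_ring PiE_def Pi_def)
      ultimately show ?thesis
        using h[of \<sigma>] operation_mod[OF vs(2) map_mod_in_tuples] xs by (simp add: cong_def)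
    next
      case False
      then show ?thesis using f by (auto simp: H_def compose_ops_def PiE_def extensional_def)
    qed
  qed
  moreover have "(n, H) \<in> C"
    unfolding H_def by (rule compose_in_C) (use vs n pr projection_in_C in auto)
  ultimately show ?thesis by simp
qed

end


section \<open>Functions on a prime field\<close>

lemma fermat_int:
  assumes "prime p" "\<not> int p dvd t"
  shows "[t ^ (p - 1) = 1] (mod int p)"
proof -
  define a where "a = nat (t mod int p)"
  have a: "int a = t mod int p" using prime_gt_0_nat[OF assms(1)] by (simp add: a_def)
  then have "\<not> p dvd a" using assms(2)
    by (metis dvd_mod_iff dvd_refl int_dvd_int_iff)
  from fermat_theorem[OF assms(1) this] have "[int a ^ (p - 1) = 1] (mod int p)"
    by (metis cong_int_iff of_nat_1 of_nat_power)
  then show ?thesis by (simp add: a cong_def power_mod)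
qed

lemma power_prime_cong:
  assumes "prime p"
  shows "[t ^ Suc (k * (p - 1)) = t] (mod int p)"
proof (cases "int p dvd t")
  case True
  then have "[t = 0] (mod int p)" "[t ^ Suc (k * (p - 1)) = 0] (mod int p)"
    by (auto simp: cong_0_iff)
  then show ?thesis using cong_sym cong_trans by blast
next
  case False
  have "[(t ^ (p - 1)) ^ k = 1 ^ k] (mod int p)"
    by (rule cong_pow[OF fermat_int[OF assms False]])
  then have "[t * (t ^ (p - 1)) ^ k = t * 1] (mod int p)"
    by (intro cong_scalar_left) simp
  then show ?thesis by (simp add: power_mult mult.commute[of k])
qed

lemma prod_lessThan_add:
  fixes f :: "nat \<Rightarrow> 'a :: comm_monoid_mult"
  shows "(\<Prod>i<m + n. f i) = (\<Prod>i<m. f i) * (\<Prod>i<n. f (m + i))"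
  by (induction n) (simp_all add: mult.assoc)

text \<open>
  By Fermat's theorem \<open>1 - (t - a)^(p-1)\<close> is the indicator function of the residue \<open>a\<close>, so every
  function on \<open>\<int>/p\<close> is a polynomial of degree below \<open>p\<close>.  What matters later is that its
  coefficients are fixed linear combinations \<open>K\<close> of the values.
\<close>

lemma interpolation_mod_prime:
  assumes p: "prime p"
  obtains K :: "nat \<Rightarrow> nat \<Rightarrow> int" where
    "\<And>h t. [h (t mod int p) = (\<Sum>j<p. (\<Sum>a<p. K j a * h (int a)) * t ^ j)] (mod int p)"
proof
  define K where "K j a = of_bool (j = 0) - int (p - 1 choose j) * (- int a) ^ (p - 1 - j)" for j a
  have p1: "p > 1" using p by (rule prime_gt_1_nat)
  have indicator: "[of_bool (t mod int p = int a) = (\<Sum>j<p. K j a * t ^ j)] (mod int p)"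
    if a: "a < p" for a t
  proof -
    have "K j a * t ^ j = (if j = 0 then 1 else 0) - int (p - 1 choose j) * t ^ j * (- int a) ^ (p - 1 - j)" for j
      by (simp add: K_def left_diff_distrib)
    moreover have "{..<p} = {..p - 1}"
      using p1 lessThan_Suc_atMost[of "p - 1"] by simp
    ultimately have "(\<Sum>j<p. K j a * t ^ j)
        = 1 - (\<Sum>j\<le>p - 1. int (p - 1 choose j) * t ^ j * (- int a) ^ (p - 1 - j))"
      by (simp add: sum_subtractf)
    also have "\<dots> = 1 - (t - int a) ^ (p - 1)"
      using binomial_ring[of t "- int a" "p - 1"] by simp
    finally have sum: "(\<Sum>j<p. K j a * t ^ j) = 1 - (t - int a) ^ (p - 1)" .
    have "t mod int p = int a \<longleftrightarrow> int p dvd t - int a"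
      using a by (metis mod_eq_dvd_iff mod_pos_pos_trivial of_nat_0_le_iff of_nat_less_iff)
    moreover have "[0 = 1 - (t - int a) ^ (p - 1)] (mod int p)" if "\<not> int p dvd t - int a"
      using cong_diff[OF cong_refl[of 1] fermat_int[OF p that]] by (simp add: cong_sym_eq)
    moreover have "[1 = 1 - (t - int a) ^ (p - 1)] (mod int p)" if "int p dvd t - int a"
    proof -
      have "int p dvd (t - int a) ^ (p - 1)"
        using that p1 by (simp add: dvd_power_le dvd_trans[OF that dvd_power])
      then show ?thesis by (simp add: cong_iff_dvd_diff)
    qed
    ultimately show ?thesis unfolding sum by (cases "int p dvd t - int a") auto
  qed
  fix h :: "int \<Rightarrow> int" and t :: int
  have "nat (t mod int p) < p" using p1 by (simp add: nat_less_iff)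
  then have "h (t mod int p) = (\<Sum>a<p. h (int a) * of_bool (a = nat (t mod int p)))"
    using p1 by (simp add: of_bool_def if_distrib sum.delta cong: if_cong)
  also have "\<dots> = (\<Sum>a<p. h (int a) * of_bool (t mod int p = int a))"
    using p1 by (intro sum.cong refl arg_cong[where f = "\<lambda>b. _ * of_bool b"]) auto
  also have "[\<dots> = (\<Sum>a<p. h (int a) * (\<Sum>j<p. K j a * t ^ j))] (mod int p)"
    by (intro cong_sum cong_scalar_left indicator) simp
  also have "(\<Sum>a<p. h (int a) * (\<Sum>j<p. K j a * t ^ j)) = (\<Sum>j<p. (\<Sum>a<p. K j a * h (int a)) * t ^ j)"
    unfolding sum_distrib_left sum_distrib_right by (subst sum.swap) (simp add: mult_ac)
  finally show "[h (t mod int p) = (\<Sum>j<p. (\<Sum>a<p. K j a * h (int a)) * t ^ j)] (mod int p)" .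
qed

section \<open>The part of a clone with values in one prime field\<close>

text \<open>By Fermat's theorem this power is 1 modulo \<open>p\<close>, and it is visibly 0 modulo \<open>q\<close>.\<close>

definition idempotent :: "nat \<Rightarrow> nat \<Rightarrow> int" where
  "idempotent p q = int q ^ (p - 1)"

text \<open>
  The first argument carries the variables over \<open>\<int>/p\<close> and the second those over \<open>\<int>/q\<close>.  Since
  the idempotent is divisible by \<open>q\<close>, membership depends only on the values of \<open>G\<close> modulo \<open>p\<close>.
\<close>

definition prime_part ::
  "nat \<Rightarrow> nat \<Rightarrow> (nat \<times> (int list \<Rightarrow> int)) set \<Rightarrow> ((nat \<Rightarrow> int) \<Rightarrow> (nat \<Rightarrow> int) \<Rightarrow> int) set" where
  "prime_part p q C = {G. (\<lambda>\<sigma>. idempotent p q * G (\<lambda>i. \<sigma> (Inl i)) (\<lambda>i. \<sigma> (Inr i)))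
     \<in> clone_functions (p * q) C}"

definition slice ::
  "nat \<Rightarrow> nat \<Rightarrow> (nat \<times> (int list \<Rightarrow> int)) set \<Rightarrow> nat \<Rightarrow> (nat \<times> (int list \<Rightarrow> int)) set" where
  "slice p q C d = {(n, f). n \<ge> 1 \<and> f \<in> tuples n (carrier (\<Z> q)) \<rightarrow>\<^sub>E carrier (\<Z> p) \<and>
     (\<lambda>x y. (\<Prod>i<d. x i) * f (map (\<lambda>i. y i mod int q) [0..<n])) \<in> prime_part p q C}"

text \<open>
  The equation \<open>g x y = g (reduce X p x) (reduce Y q y)\<close> expresses at once that \<open>g\<close> depends only on
  the variables in \<open>X\<close> and \<open>Y\<close>, and on these only modulo \<open>p\<close> and \<open>q\<close>.
\<close>

definition reduce :: "nat set \<Rightarrow> nat \<Rightarrow> (nat \<Rightarrow> int) \<Rightarrow> nat \<Rightarrow> int" where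
  "reduce X m x = (\<lambda>i. if i \<in> X then x i mod int m else 0)"

locale clone_at_prime =
  fixes p q :: nat and C :: "(nat \<times> (int list \<Rightarrow> int)) set"
  assumes p: "prime p" and q: "prime q" and p_neq_q: "p \<noteq> q"
    and above_pq: "C \<in> clones_above_add (p * q)"
begin

sublocale clone_above_addition "p * q" C
  using less_1_mult[OF prime_gt_1_nat[OF p] prime_gt_1_nat[OF q]] above_pq by unfold_locales

lemma p_gt_1: "p > 1" using p prime_gt_1_nat by blast
lemma q_gt_1: "q > 1" using q prime_gt_1_nat by blast

abbreviation "e \<equiv> idempotent p q"

lemma idempotent_mod_p: "[e = 1] (mod int p)"
proof -
  have "\<not> int p dvd int q"
    using p q p_neq_q by (simp add: primes_dvd_imp_eq) (use primes_dvd_imp_eq in blast)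
  then show ?thesis unfolding idempotent_def by (rule fermat_int[OF p])
qed

lemma idempotent_scale_cong: "[z = e * z] (mod int p)"
  using cong_scalar_right[OF idempotent_mod_p, of z] by (simp add: cong_sym_eq)

lemma q_dvd_idempotent: "int q dvd e"
  unfolding idempotent_def using p_gt_1 by (intro dvd_power) simp

lemma idempotent_cong:
  assumes "[a = b] (mod int p)"
  shows "[e * a = e * b] (mod int (p * q))"
proof -
  have "int p dvd a - b" using assms by (simp add: cong_iff_dvd_diff)
  then have "int q * int p dvd e * (a - b)" using q_dvd_idempotent by (rule mult_dvd_mono[rotated])
  then show ?thesis by (simp add: cong_iff_dvd_diff algebra_simps)
qed

lemma prime_part_cong:
  assumes "G \<in> prime_part p q C" "\<And>x y. [H x y = G x y] (mod int p)"
  shows "H \<in> prime_part p q C"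
  using assms unfolding prime_part_def mem_Collect_eq
  by (elim clone_functions_cong) (rule idempotent_cong)

lemma prime_part_scale: "G \<in> prime_part p q C \<Longrightarrow> (\<lambda>x y. c * G x y) \<in> prime_part p q C"
  unfolding prime_part_def mem_Collect_eq
  by (drule clone_functions_scale[where c = c]) (simp add: algebra_simps)

lemma prime_part_sum:
  assumes "\<And>i. i \<in> I \<Longrightarrow> G i \<in> prime_part p q C"
  shows "(\<lambda>x y. \<Sum>i\<in>I. G i x y) \<in> prime_part p q C"
  using assms unfolding prime_part_def mem_Collect_eq
  by (simp add: sum_distrib_left clone_functions_sum)

lemma prime_part_add:
  "G \<in> prime_part p q C \<Longrightarrow> H \<in> prime_part p q C \<Longrightarrow> (\<lambda>x y. G x y + H x y) \<in> prime_part p q C"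
  unfolding prime_part_def mem_Collect_eq
  by (drule (1) clone_functions_add) (simp add: algebra_simps)

lemma prime_part_diff:
  assumes "G \<in> prime_part p q C" "H \<in> prime_part p q C"
  shows "(\<lambda>x y. G x y - H x y) \<in> prime_part p q C"
  using prime_part_add[OF assms(1) prime_part_scale[OF assms(2), of "-1"]] by simp

text \<open>
  The substituted terms must represent clone members modulo \<open>p * q\<close>.  To insert a member \<open>H\<close> of
  \<open>prime_part\<close> itself, substitute \<open>e * H\<close>, which agrees with \<open>H\<close> modulo \<open>p\<close>.
\<close>

lemma prime_part_subst:
  assumes G: "G \<in> prime_part p q C"
    and a: "\<And>v. (\<lambda>\<sigma>. a v (\<lambda>i. \<sigma> (Inl i)) (\<lambda>i. \<sigma> (Inr i))) \<in> clone_functions (p * q) C"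
    and b: "\<And>v. (\<lambda>\<sigma>. b v (\<lambda>i. \<sigma> (Inl i)) (\<lambda>i. \<sigma> (Inr i))) \<in> clone_functions (p * q) C"
  shows "(\<lambda>x y. G (\<lambda>v. a v x y) (\<lambda>v. b v x y)) \<in> prime_part p q C"
proof -
  define S where "S v = (\<lambda>\<sigma>. case v of Inl i \<Rightarrow> a i (\<lambda>i. \<sigma> (Inl i)) (\<lambda>i. \<sigma> (Inr i))
      | Inr i \<Rightarrow> b i (\<lambda>i. \<sigma> (Inl i)) (\<lambda>i. \<sigma> (Inr i)))" for v
  have "S v \<in> clone_functions (p * q) C" for v
    unfolding S_def by (cases v) (simp_all add: a b)
  from clone_functions_subst[where S = S, OF G[unfolded prime_part_def mem_Collect_eq] this]
  show ?thesis by (simp add: prime_part_def S_def)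
qed

lemma prime_part_rename:
  assumes "G \<in> prime_part p q C"
  shows "(\<lambda>x y. G (\<lambda>v. x (r v)) y) \<in> prime_part p q C"
  using assms by (rule prime_part_subst) (rule variable_in_clone_functions)+

section \<open>The slices and their periodicity\<close>

text \<open>
  The product of the variables over \<open>\<int>/p\<close> is a bystander: linear combinations are formed behind it,
  and a matrix over \<open>\<int>/q\<close> is substituted into the remaining variables by repeated addition.
\<close>

lemma slice_clonoid: "slice p q C d \<in> clonoids p q"
proof -
  let ?R = "carrier (\<Z> p)" and ?S = "carrier (\<Z> q)"
  have mod_tuple: "map (\<lambda>i. y i mod int q) [0..<n] \<in> tuples n ?S" for y n
    using q_gt_1 by (auto simp: tuples_def carrier_residue_ring)
  have nonempty: "slice p q C d \<noteq> {}"
  proof -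
    have "(\<lambda>x y. 0) \<in> prime_part p q C"
      using prime_part_sum[of "{}"] by simp
    then have "(1, \<lambda>xs\<in>tuples 1 ?S. 0) \<in> slice p q C d"
      using mod_tuple[of _ 1] p_gt_1 by (simp add: slice_def carrier_residue_ring)
    then show ?thesis by blast
  qed
  have finitary: "slice p q C d \<subseteq> finitary_functions ?S ?R"
    by (auto simp: slice_def finitary_functions_def)
  have combination: "(n, \<lambda>xs\<in>tuples n ?S. a \<otimes>\<^bsub>\<Z> p\<^esub> f xs \<oplus>\<^bsub>\<Z> p\<^esub> b \<otimes>\<^bsub>\<Z> p\<^esub> g xs) \<in> slice p q C d"
    if f: "(n, f) \<in> slice p q C d" and g: "(n, g) \<in> slice p q C d" for n f g a b
  proof -
    let ?y = "\<lambda>y. map (\<lambda>i. y i mod int q) [0..<n]"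
    let ?h = "\<lambda>xs\<in>tuples n ?S. a \<otimes>\<^bsub>\<Z> p\<^esub> f xs \<oplus>\<^bsub>\<Z> p\<^esub> b \<otimes>\<^bsub>\<Z> p\<^esub> g xs"
    have "(\<lambda>x y. a * ((\<Prod>i<d. x i) * f (?y y)) + b * ((\<Prod>i<d. x i) * g (?y y))) \<in> prime_part p q C"
      using f g by (intro prime_part_add prime_part_scale) (simp_all add: slice_def)
    then have "(\<lambda>x y. (\<Prod>i<d. x i) * ?h (?y y)) \<in> prime_part p q C"
    proof (rule prime_part_cong)
      fix x y :: "nat \<Rightarrow> int"
      have "[?h (?y y) = a * f (?y y) + b * g (?y y)] (mod int p)"
        using mod_tuple[of y n] by (simp add: add_residue_ring mult_residue_ring cong_def mod_simps)
      moreover have "a * ((\<Prod>i<d. x i) * f (?y y)) + b * ((\<Prod>i<d. x i) * g (?y y))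
          = (\<Prod>i<d. x i) * (a * f (?y y) + b * g (?y y))"
        by (simp add: algebra_simps)
      ultimately show "[(\<Prod>i<d. x i) * ?h (?y y)
          = a * ((\<Prod>i<d. x i) * f (?y y)) + b * ((\<Prod>i<d. x i) * g (?y y))] (mod int p)"
        by (simp only: cong_scalar_left)
    qed
    then show ?thesis
      using f p_gt_1 by (auto simp: slice_def carrier_residue_ring add_residue_ring)
  qed
  have linear: "(n, \<lambda>xs\<in>tuples n ?S. f (mat_vec (\<Z> q) m n M xs)) \<in> slice p q C d"
    if f: "(m, f) \<in> slice p q C d" and n: "n \<ge> 1" for m n f M
  proof -
    interpret R: residues "int q" "\<Z> q" by unfold_locales (use q_gt_1 in simp_all)
    have entries: "mat_vec (\<Z> q) m n M xs = map (\<lambda>i. (\<Sum>j<n. M i j * xs ! j) mod int q) [0..<m]" for xs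
      unfolding mat_vec_def mult_residue_ring by (subst R.sum_cong) simp_all
    let ?h = "\<lambda>xs\<in>tuples n ?S. f (mat_vec (\<Z> q) m n M xs)"
    have "(\<lambda>x y. (\<Prod>i<d. x i) * f (map (\<lambda>i. (\<Sum>j<n. M i j * y j) mod int q) [0..<m])) \<in> prime_part p q C"
      using f[unfolded slice_def]
      by (intro prime_part_subst[where G = "\<lambda>x y. (\<Prod>i<d. x i) * f (map (\<lambda>i. y i mod int q) [0..<m])"
            and a = "\<lambda>v x y. x v" and b = "\<lambda>v x y. \<Sum>j<n. M v j * y j"]
          clone_functions_sum clone_functions_scale variable_in_clone_functions) simp
    moreover have "?h (map (\<lambda>i. y i mod int q) [0..<n])
        = f (map (\<lambda>i. (\<Sum>j<n. M i j * y j) mod int q) [0..<m])" for y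
    proof -
      have "(\<Sum>j<n. M i j * (map (\<lambda>i. y i mod int q) [0..<n]) ! j) mod int q
          = (\<Sum>j<n. M i j * y j) mod int q" for i
        by (subst (1 2) mod_sum_eq[symmetric]) (simp add: mod_simps)
      then show ?thesis using mod_tuple[of y n] by (simp add: entries)
    qed
    moreover have "?h \<in> tuples n ?S \<rightarrow>\<^sub>E ?R"
      using f mod_tuple by (auto simp: slice_def entries)
    ultimately show ?thesis
      using n by (simp add: slice_def)
  qed
  show ?thesis
    unfolding clonoids_def linearly_closed_clonoid_def mem_Collect_eq arity_part_def
    using nonempty finitary combination linear by blast
qed


text \<open>
  Identifying the surplus variables with \<open>x_0\<close> multiplies \<open>x_0\<close> by a power of \<open>x_0^(p-1)\<close>, which
  does not change it modulo \<open>p\<close>.  A variable \<open>x_0\<close> has to survive, hence \<open>d \<ge> 1\<close>.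
\<close>

lemma slice_reduce:
  assumes "d \<ge> 1"
  shows "slice p q C (d + t * (p - 1)) \<subseteq> slice p q C d"
proof clarify
  fix n f assume f: "(n, f) \<in> slice p q C (d + t * (p - 1))"
  define r where "r i = (if i < d then i else 0)" for i :: nat
  let ?f = "\<lambda>y. f (map (\<lambda>i. y i mod int q) [0..<n])"
  have "(\<lambda>x y. (\<Prod>i<d + t * (p - 1). x (r i)) * ?f y) \<in> prime_part p q C"
    by (rule prime_part_rename) (use f in \<open>simp add: slice_def\<close>)
  moreover have "[(\<Prod>i<d. x i) = (\<Prod>i<d + t * (p - 1). x (r i))] (mod int p)" for x
  proof -
    obtain d' where d: "d = Suc d'" using assms by (cases d) auto
    have "(\<Prod>i<d + t * (p - 1). x (r i)) = (\<Prod>i<d. x i) * x 0 ^ (t * (p - 1))"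
      by (simp add: prod_lessThan_add r_def)
    also have "\<dots> = x 0 ^ Suc (t * (p - 1)) * (\<Prod>i<d'. x (Suc i))"
      unfolding d prod.lessThan_Suc_shift by simp
    also have "[\<dots> = x 0 * (\<Prod>i<d'. x (Suc i))] (mod int p)"
      by (rule cong_scalar_right[OF power_prime_cong[OF p]])
    also have "x 0 * (\<Prod>i<d'. x (Suc i)) = (\<Prod>i<d. x i)"
      unfolding d prod.lessThan_Suc_shift by simp
    finally show ?thesis by (rule cong_sym)
  qed
  ultimately have "(\<lambda>x y. (\<Prod>i<d. x i) * ?f y) \<in> prime_part p q C"
    by (elim prime_part_cong) (rule cong_scalar_right)
  then show "(n, f) \<in> slice p q C d" using f by (simp add: slice_def)
qed

text \<open>
  Substituting a function into itself \<open>p - 1\<close> times restores \<open>f\<close>, as \<open>f^p = f\<close>, but overshoots: it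
  leaves \<open>d + (p - 1) * (d - 1)\<close> linear factors.  As \<open>d \<ge> 2\<close>, this number is \<open>d + (p - 1)\<close> plus a
  non-negative multiple of \<open>p - 1\<close>, and the surplus is removed by \<open>slice_reduce\<close>.
\<close>

lemma slice_raise:
  assumes "d \<ge> 2"
  shows "slice p q C d \<subseteq> slice p q C (d + (p - 1))"
proof clarify
  fix n f assume f: "(n, f) \<in> slice p q C d"
  let ?f = "\<lambda>y. f (map (\<lambda>i. y i mod int q) [0..<n])"
  obtain d' where d: "d = Suc (Suc d')" using assms by (metis Suc_le_D add_2_eq_Suc le_iff_add)
  have G: "(\<lambda>x y. (\<Prod>i<d. x i) * ?f y) \<in> prime_part p q C"
    using f by (simp add: slice_def)
  have power: "(\<lambda>x y. (\<Prod>i<d + k * (d - 1). x i) * ?f y ^ Suc k) \<in> prime_part p q C" for k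
  proof (induction k)
    case 0
    show ?case using G by simp
  next
    case (Suc k)
    define D where "D = d + k * (d - 1)"
    \<comment> \<open>The first variable receives the power built so far, the others are moved beyond its \<open>D\<close> variables.\<close>
    define a where "a v x y = (if v = 0 then e * ((\<Prod>i<D. x i) * ?f y ^ Suc k) else x (D + v - 1))"
      for v and x y :: "nat \<Rightarrow> int"
    have "(\<lambda>\<sigma>. a v (\<lambda>i. \<sigma> (Inl i)) (\<lambda>i. \<sigma> (Inr i))) \<in> clone_functions (p * q) C" for v
      using Suc.IH unfolding prime_part_def mem_Collect_eq D_def[symmetric]
      by (cases "v = 0") (simp_all add: a_def variable_in_clone_functions)
    then have "(\<lambda>x y. (\<Prod>i<d. a i x y) * ?f y) \<in> prime_part p q C"
      by (intro prime_part_subst[OF G, where b = "\<lambda>v x y. y v"] variable_in_clone_functions)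
    then show ?case
    proof (rule prime_part_cong)
      fix x y :: "nat \<Rightarrow> int"
      have "(\<Prod>i<d. a i x y) * ?f y = e * ((\<Prod>i<D + (d - 1). x i) * ?f y ^ Suc (Suc k))"
        unfolding prod_lessThan_add by (subst d, subst prod.lessThan_Suc_shift)
          (simp add: a_def d algebra_simps del: prod.lessThan_Suc)
      moreover have "D + (d - 1) = d + Suc k * (d - 1)"
        by (simp add: D_def)
      ultimately have a_eq: "(\<Prod>i<d. a i x y) * ?f y
          = e * ((\<Prod>i<d + Suc k * (d - 1). x i) * ?f y ^ Suc (Suc k))"
        by (simp only:)
      show "[(\<Prod>i<d + Suc k * (d - 1). x i) * ?f y ^ Suc (Suc k)
          = (\<Prod>i<d. a i x y) * ?f y] (mod int p)"
        unfolding a_eq by (rule idempotent_scale_cong)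
    qed
  qed
  have exponent: "d + (p - 1) * (d - 1) = (d + (p - 1)) + d' * (p - 1)"
    by (simp add: d)
  have "(\<lambda>x y. (\<Prod>i<(d + (p - 1)) + d' * (p - 1). x i) * ?f y) \<in> prime_part p q C"
    by (rule prime_part_cong[OF power[of "p - 1", unfolded exponent]])
      (rule cong_scalar_left[OF cong_sym], use power_prime_cong[OF p, of _ 1] in simp)
  then have "(n, f) \<in> slice p q C ((d + (p - 1)) + d' * (p - 1))"
    using f by (simp add: slice_def)
  then show "(n, f) \<in> slice p q C (d + (p - 1))"
    using slice_reduce[of "d + (p - 1)" d'] d by auto
qed

section \<open>The slices determine the clone\<close>

text \<open>
  If \<open>F\<close> has degree at most \<open>J\<close> in the variable \<open>v\<close>, then the difference \<open>F(x_v + x_u) - F(x_v)\<close> has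
  degree at most \<open>J - 1\<close>, and its leading coefficient is \<open>J x_u\<close> times that of \<open>F\<close>.  Taking \<open>J\<close>
  differences produces \<open>J!\<close> times the required product, and \<open>J!\<close> is invertible modulo \<open>p\<close>.
\<close>

lemma polarization:
  assumes "finite U" "card U = J" "v \<notin> U" "J < p" "F \<in> prime_part p q C"
    and "\<And>x y. [F x y = (\<Sum>j\<le>J. c j x y * x v ^ j)] (mod int p)"
    and "\<And>j x y t. c j (x(v := t)) y = c j x y"
  shows "(\<lambda>x y. (\<Prod>u\<in>U. x u) * c J x y) \<in> prime_part p q C"
  using assms
proof (induction J arbitrary: U F c)
  case 0
  have "(\<lambda>x y. c 0 x y) \<in> prime_part p q C"
    by (rule prime_part_cong[OF 0(5)]) (use 0(6) in \<open>simp add: cong_sym_eq\<close>)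
  then show ?case using 0(1,2) by simp
next
  case (Suc J)
  obtain u U' where U: "U = insert u U'" "u \<notin> U'" "finite U'" "card U' = J"
    using Suc.prems(1,2) by (metis card_Suc_eq finite_insert)
  have uv: "u \<noteq> v" "v \<notin> U'" using Suc.prems(3) U by auto
  define F' where "F' x y = F (x(v := x v + x u)) y - F x y" for x y
  define c' where "c' i x y = (\<Sum>j | j \<in> {..Suc J} \<and> i < j. c j x y * int (j choose i) * x u ^ (j - i))"
    for i and x y :: "nat \<Rightarrow> int"
  have "(\<lambda>x y. F (\<lambda>w. if w = v then x v + x u else x w) y) \<in> prime_part p q C"
  proof (rule prime_part_subst[OF Suc.prems(5), where b = "\<lambda>v x y. y v"])
    fix w
    show "(\<lambda>\<sigma>. if w = v then \<sigma> (Inl v) + \<sigma> (Inl u) else \<sigma> (Inl w)) \<in> clone_functions (p * q) C"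
      by (cases "w = v") (simp_all add: variable_in_clone_functions clone_functions_add)
  qed (rule variable_in_clone_functions)
  then have F'_in: "F' \<in> prime_part p q C"
    unfolding F'_def fun_upd_def using Suc.prems(5) by (intro prime_part_diff)
  have F'_poly: "[F' x y = (\<Sum>i\<le>J. c' i x y * x v ^ i)] (mod int p)" for x y
  proof -
    have diff: "(s + t) ^ j - s ^ j = (\<Sum>i<j. int (j choose i) * s ^ i * t ^ (j - i))" for s t :: int and j
      unfolding binomial_ring lessThan_Suc_atMost[symmetric] by simp
    have "[F (x(v := x v + x u)) y = (\<Sum>j\<le>Suc J. c j x y * (x v + x u) ^ j)] (mod int p)"
      using Suc.prems(6)[of "x(v := x v + x u)" y] by (simp only: Suc.prems(7) fun_upd_same)
    then have "[F' x y = (\<Sum>j\<le>Suc J. c j x y * (x v + x u) ^ j) - (\<Sum>j\<le>Suc J. c j x y * x v ^ j)] (mod int p)"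
      unfolding F'_def by (rule cong_diff[OF _ Suc.prems(6)])
    also have "(\<Sum>j\<le>Suc J. c j x y * (x v + x u) ^ j) - (\<Sum>j\<le>Suc J. c j x y * x v ^ j)
        = (\<Sum>j\<le>Suc J. c j x y * ((x v + x u) ^ j - x v ^ j))"
      by (simp only: sum_subtractf right_diff_distrib)
    also have "\<dots> = (\<Sum>j\<le>Suc J. \<Sum>i | i \<in> {..J} \<and> i < j. c j x y * int (j choose i) * x u ^ (j - i) * x v ^ i)"
    proof (rule sum.cong[OF refl])
      fix j assume "j \<in> {..Suc J}"
      then have "{i. i \<in> {..J} \<and> i < j} = {..<j}" by auto
      then show "c j x y * ((x v + x u) ^ j - x v ^ j)
          = (\<Sum>i | i \<in> {..J} \<and> i < j. c j x y * int (j choose i) * x u ^ (j - i) * x v ^ i)"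
        by (simp add: diff sum_distrib_left mult_ac)
    qed
    also have "\<dots> = (\<Sum>i\<le>J. c' i x y * x v ^ i)"
      unfolding c'_def sum_distrib_right by (rule sum.swap_restrict) simp_all
    finally show ?thesis .
  qed
  have c'_v: "c' j (x(v := t)) y = c' j x y" for j x y t
    using uv by (simp add: c'_def Suc.prems(7))
  have "(\<lambda>x y. (\<Prod>u\<in>U'. x u) * c' J x y) \<in> prime_part p q C"
    using U(3,4) uv(2) Suc_lessD[OF Suc.prems(4)] F'_in F'_poly c'_v by (rule Suc.IH)
  moreover have "{j. j \<in> {..Suc J} \<and> J < j} = {Suc J}" by auto
  then have "c' J x y = c (Suc J) x y * int (Suc J) * x u" for x y
    by (simp add: c'_def)
  ultimately have scaled: "(\<lambda>x y. int (Suc J) * ((\<Prod>u\<in>U. x u) * c (Suc J) x y)) \<in> prime_part p q C"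
    using U by (simp add: mult_ac)
  have "\<not> p dvd Suc J" using Suc.prems(4) by (auto dest: dvd_imp_le)
  then have "coprime (int (Suc J)) (int p)"
    using p by (simp add: prime_imp_coprime coprime_commute del: of_nat_Suc)
  then obtain b where b: "[int (Suc J) * b = 1] (mod int p)"
    using cong_solve_coprime_int by blast
  show ?case
  proof (rule prime_part_cong[OF prime_part_scale[OF scaled, of b]])
    fix x y :: "nat \<Rightarrow> int"
    from cong_scalar_right[OF b, of "(\<Prod>u\<in>U. x u) * c (Suc J) x y"]
    show "[(\<Prod>u\<in>U. x u) * c (Suc J) x y = b * (int (Suc J) * ((\<Prod>u\<in>U. x u) * c (Suc J) x y))] (mod int p)"
      by (simp add: mult_ac cong_sym_eq)
  qed
qed


text \<open>
  Induction on the set \<open>X\<close> of variables over \<open>\<int>/p\<close> that occur in the coefficient \<open>g\<close>; the set \<open>U\<close> of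
  linear factors has to be arbitrary because polarization enlarges it.  Without such variables the
  function is, up to renaming, of the form that the slices speak of.  Otherwise \<open>g\<close> is a polynomial
  in one variable \<open>v\<close> of \<open>X\<close>, and its monomials are transferred to \<open>D\<close> one at a time, starting from
  the leading one.
\<close>

lemma prime_part_subset:
  assumes D: "D \<in> clones_above_add (p * q)"
    and slices: "\<And>d. slice p q C d \<subseteq> slice p q D d"
    and "finite X" "finite U" "U \<inter> X = {}" "n \<ge> 1"
    and "\<And>x y. g x y = g (reduce X p x) (reduce {..<n} q y)"
    and "(\<lambda>x y. (\<Prod>u\<in>U. x u) * g x y) \<in> prime_part p q C"
  shows "(\<lambda>x y. (\<Prod>u\<in>U. x u) * g x y) \<in> prime_part p q D"
proof -
  interpret D: clone_at_prime p q D
    using p q p_neq_q D by unfold_locales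
  show ?thesis
    using assms(3-)
  proof (induction X arbitrary: U g rule: finite_induct)
    case empty
    define k where "k = card U"
    obtain h where h: "bij_betw h {..<k} U"
      using ex_bij_betw_nat_finite[OF \<open>finite U\<close>] by (auto simp: k_def lessThan_atLeast0)
    define r where "r = the_inv_into {..<k} h"
    define f where "f = (\<lambda>ys\<in>tuples n (carrier (\<Z> q)). g (\<lambda>_. 0) (\<lambda>i. if i < n then ys ! i else 0) mod int p)"
    have prod_U: "(\<Prod>u\<in>U. x u) = (\<Prod>i<k. x (h i))" for x :: "nat \<Rightarrow> int"
      using prod.reindex_bij_betw[OF h, of x] by simp
    have f: "f (map (\<lambda>i. y i mod int q) [0..<n]) = g x y mod int p" for x y
    proof -
      have "map (\<lambda>i. y i mod int q) [0..<n] \<in> tuples n (carrier (\<Z> q))"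
        using q_gt_1 by (auto simp: tuples_def carrier_residue_ring)
      moreover have "(\<lambda>i. if i < n then map (\<lambda>i. y i mod int q) [0..<n] ! i else 0) = reduce {..<n} q y"
        by (auto simp: reduce_def)
      ultimately show ?thesis
        using empty.prems(4)[of x y] by (simp add: f_def reduce_def[of "{}"])
    qed
    have "g x y = g x' y" for x x' y
      using empty.prems(4)[of x y] empty.prems(4)[of x' y] by (simp add: reduce_def[of "{}"])
    then have "(\<lambda>x y. (\<Prod>u\<in>U. x (r u)) * g (\<lambda>v. x (r v)) y) = (\<lambda>x y. (\<Prod>u\<in>U. x (r u)) * g x y)"
      by (intro ext arg_cong2[where f = "(*)"] refl)
    with prime_part_rename[OF empty.prems(5), of r]
    have "(\<lambda>x y. (\<Prod>u\<in>U. x (r u)) * g x y) \<in> prime_part p q C"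
      by simp
    then have "(\<lambda>x y. (\<Prod>i<k. x i) * f (map (\<lambda>i. y i mod int q) [0..<n])) \<in> prime_part p q C"
    proof (rule prime_part_cong)
      fix x y :: "nat \<Rightarrow> int"
      have "(\<Prod>u\<in>U. x (r u)) = (\<Prod>i<k. x i)"
        unfolding prod_U using h by (intro prod.cong) (auto simp: r_def the_inv_into_f_f bij_betw_def)
      then show "[(\<Prod>i<k. x i) * f (map (\<lambda>i. y i mod int q) [0..<n]) = (\<Prod>u\<in>U. x (r u)) * g x y] (mod int p)"
        by (simp add: f[of _ x] cong_def mod_simps)
    qed
    then have "(n, f) \<in> slice p q C k"
      using \<open>n \<ge> 1\<close> p_gt_1 by (auto simp: slice_def f_def carrier_residue_ring)
    then have "(n, f) \<in> slice p q D k" using slices by blast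
    then have "(\<lambda>x y. (\<Prod>i<k. x i) * f (map (\<lambda>i. y i mod int q) [0..<n])) \<in> prime_part p q D"
      by (simp add: slice_def)
    from D.prime_part_rename[OF this, of h] show ?case
    proof (rule D.prime_part_cong)
      show "[(\<Prod>u\<in>U. x u) * g x y
          = (\<Prod>i<k. x (h i)) * f (map (\<lambda>i. y i mod int q) [0..<n])] (mod int p)" for x y
        by (simp add: prod_U f[of _ x] cong_def mod_simps)
    qed
  next
    case (insert v X)
    obtain K where K: "\<And>h t. [h (t mod int p) = (\<Sum>j<p. (\<Sum>a<p. K j a * h (int a)) * t ^ j)] (mod int p)"
      using interpolation_mod_prime[OF p] by blast
    define c where "c j x y = (\<Sum>a<p. K j a * g (x(v := int a)) y)" for j :: nat and x y
    have v: "v \<notin> U" and UX: "U \<inter> X = {}" using insert.prems(2) by auto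
    have c_v: "c j (x(v := t)) y = c j x y" for j x y t
      by (simp add: c_def)
    have g_eq: "g x y = g x' y'"
      if "reduce (insert v X) p x = reduce (insert v X) p x'" "reduce {..<n} q y = reduce {..<n} q y'"
      for x x' y y'
      using insert.prems(4)[of x y] insert.prems(4)[of x' y'] that by simp
    have c_reduce: "c j x y = c j (reduce X p x) (reduce {..<n} q y)" for j x y
    proof -
      have "g (x(v := t)) y = g ((reduce X p x)(v := t)) (reduce {..<n} q y)" for t
        by (rule g_eq) (auto simp: reduce_def)
      then show ?thesis by (simp add: c_def)
    qed
    have g_poly: "[g x y = (\<Sum>j<p. c j x y * x v ^ j)] (mod int p)" for x y
    proof -
      have "g x y = g (x(v := x v mod int p)) y"
        by (rule g_eq) (auto simp: reduce_def)
      then show ?thesis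
        using K[of "\<lambda>t. g (x(v := t)) y" "x v"] by (simp add: c_def)
    qed
    \<comment> \<open>Here the leading monomial of degree \<open>J\<close> is split off; fresh variables \<open>U'\<close> replace its power of \<open>v\<close>.\<close>
    have truncated: "(\<lambda>x y. (\<Prod>u\<in>U. x u) * (\<Sum>j<J. c j x y * x v ^ j)) \<in> prime_part p q D"
      if "J \<le> p" "(\<lambda>x y. (\<Prod>u\<in>U. x u) * (\<Sum>j<J. c j x y * x v ^ j)) \<in> prime_part p q C" for J
      using that
    proof (induction J)
      case 0
      show ?case using D.prime_part_sum[of "{}"] by simp
    next
      case (Suc J)
      obtain U' where U': "finite U'" "card U' = J" "U' \<inter> insert v (U \<union> X) = {}"
      proof -
        have "infinite (- insert v (U \<union> X))"
          unfolding Compl_eq_Diff_UNIV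
          using insert.hyps(1) \<open>finite U\<close> by (intro Diff_infinite_finite) auto
        from infinite_arbitrarily_large[OF this, of J] that show ?thesis by blast
      qed
      have "(\<lambda>x y. (\<Prod>u\<in>U'. x u) * ((\<Prod>u\<in>U. x u) * c J x y)) \<in> prime_part p q C"
      proof (rule polarization[where c = "\<lambda>j x y. (\<Prod>u\<in>U. x u) * c j x y"])
        show "[(\<Prod>u\<in>U. x u) * (\<Sum>j<Suc J. c j x y * x v ^ j)
            = (\<Sum>j\<le>J. (\<Prod>u\<in>U. x u) * c j x y * x v ^ j)] (mod int p)" for x y
          by (simp only: lessThan_Suc_atMost sum_distrib_left mult.assoc cong_refl)
        show "(\<Prod>u\<in>U. (x(v := t)) u) * c j (x(v := t)) y = (\<Prod>u\<in>U. x u) * c j x y" for j x y t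
          unfolding c_v using v by (intro arg_cong2[where f = "(*)"] prod.cong) auto
      qed (use U' Suc.prems in auto)
      moreover have prod: "(\<Prod>u\<in>U' \<union> U. x u) = (\<Prod>u\<in>U'. x u) * (\<Prod>u\<in>U. x u)" for x :: "nat \<Rightarrow> int"
        using U' \<open>finite U\<close> by (intro prod.union_disjoint) auto
      ultimately have lead_C: "(\<lambda>x y. (\<Prod>u\<in>U' \<union> U. x u) * c J x y) \<in> prime_part p q C"
        by (simp add: mult.assoc)
      then have lead_D: "(\<lambda>x y. (\<Prod>u\<in>U' \<union> U. x u) * c J x y) \<in> prime_part p q D"
        using U' UX \<open>finite U\<close>
        by (intro insert.IH[where g = "c J", OF _ _ \<open>n \<ge> 1\<close> c_reduce]) auto
      \<comment> \<open>Identifying the fresh variables with \<open>v\<close> turns their product back into \<open>x v ^ J\<close>.\<close>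
      define r where "r w = (if w \<in> U' then v else w)" for w
      have monomial: "(\<Prod>u\<in>U' \<union> U. x (r u)) * c J (\<lambda>w. x (r w)) y = (\<Prod>u\<in>U. x u) * (c J x y * x v ^ J)" for x y
      proof -
        have "reduce X p (\<lambda>w. x (r w)) = reduce X p x"
          using U'(3) unfolding reduce_def r_def by (intro ext) auto
        then have "c J (\<lambda>w. x (r w)) y = c J x y" 
          using c_reduce[of J "\<lambda>w. x (r w)" y] c_reduce[of J x y] by simp
        moreover have "(\<Prod>u\<in>U'. x (r u)) = x v ^ J" using U'(2) by (simp add: r_def)
        moreover have "(\<Prod>u\<in>U. x (r u)) = (\<Prod>u\<in>U. x u)"
          using U'(3) by (intro prod.cong) (auto simp: r_def)
        ultimately show ?thesis by (simp add: prod[of "\<lambda>u. x (r u)"] mult_ac)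
      qed
      have monomial_C: "(\<lambda>x y. (\<Prod>u\<in>U. x u) * (c J x y * x v ^ J)) \<in> prime_part p q C"
        using prime_part_rename[OF lead_C, of r] by (simp add: monomial)
      have monomial_D: "(\<lambda>x y. (\<Prod>u\<in>U. x u) * (c J x y * x v ^ J)) \<in> prime_part p q D"
        using D.prime_part_rename[OF lead_D, of r] by (simp add: monomial)
      have "(\<lambda>x y. (\<Prod>u\<in>U. x u) * (\<Sum>j<J. c j x y * x v ^ j)) \<in> prime_part p q C"
        using prime_part_diff[OF Suc.prems(2) monomial_C] by (simp add: algebra_simps)
      with Suc have "(\<lambda>x y. (\<Prod>u\<in>U. x u) * (\<Sum>j<J. c j x y * x v ^ j)) \<in> prime_part p q D"
        by simp
      from D.prime_part_add[OF this monomial_D] show ?case by (simp add: algebra_simps)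
    qed
    have "(\<lambda>x y. (\<Prod>u\<in>U. x u) * (\<Sum>j<p. c j x y * x v ^ j)) \<in> prime_part p q C"
      using insert.prems(5)
      by (rule prime_part_cong) (rule cong_scalar_left[OF cong_sym[OF g_poly]])
    then have "(\<lambda>x y. (\<Prod>u\<in>U. x u) * (\<Sum>j<p. c j x y * x v ^ j)) \<in> prime_part p q D"
      by (intro truncated) simp_all
    then show ?case
      by (rule D.prime_part_cong) (rule cong_scalar_left[OF g_poly])
  qed
qed

lemma other_prime: "clone_at_prime q p C"
  using p q p_neq_q above_pq by unfold_locales (simp_all add: mult.commute)

lemma idempotents_sum: "[e + idempotent q p = 1] (mod int (p * q))"
proof -
  interpret other: clone_at_prime q p C by (rule other_prime)
  have "[e + idempotent q p = 1 + 0] (mod int p)"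
    using other.q_dvd_idempotent by (intro cong_add idempotent_mod_p) (simp add: cong_0_iff)
  moreover have "[e + idempotent q p = 0 + 1] (mod int q)"
    using q_dvd_idempotent by (intro cong_add other.idempotent_mod_p) (simp add: cong_0_iff)
  moreover have "coprime (int p) (int q)"
    using p q p_neq_q by (simp add: primes_coprime)
  ultimately show ?thesis by (simp add: coprime_cong_mult)
qed

text \<open>
  Splitting each variable as \<open>e x + e' y\<close> brings an operation into the form required by
  \<open>prime_part_subset\<close>; setting \<open>x = y\<close> afterwards undoes the splitting, as the idempotents sum to 1.
\<close>

lemma idempotent_operation_transfer:
  assumes D: "D \<in> clones_above_add (p * q)"
    and slices: "\<And>d. slice p q C d \<subseteq> slice p q D d"
    and f: "(n, f) \<in> C"
  shows "(\<lambda>\<sigma>. e * f (map (\<lambda>i. \<sigma> i mod int (p * q)) [0..<n])) \<in> clone_functions (p * q) D"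
proof -
  interpret other: clone_at_prime q p C by (rule other_prime)
  interpret D: clone_at_prime p q D
    using p q p_neq_q D by unfold_locales
  have n: "n \<ge> 1" using f clone by (auto simp: is_clone_def finitary_functions_def)
  define F where "F \<sigma> = f (map (\<lambda>i. \<sigma> i mod int (p * q)) [0..<n])" for \<sigma>
  define g where "g x y = F (\<lambda>i. e * (if i < n then x i mod int p else 0)
      + idempotent q p * (if i < n then y i mod int q else 0))" for x y
  have F: "F \<in> clone_functions (p * q) C"
    unfolding F_def by (rule operation_in_clone_functions[OF f]) simp
  have F_cong: "F \<sigma> = F \<tau>" if "\<And>i. i < n \<Longrightarrow> [\<sigma> i = \<tau> i] (mod int (p * q))" for \<sigma> \<tau>
    unfolding F_def by (intro arg_cong[where f = f] map_cong refl) (use that in \<open>simp add: cong_def\<close>)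
  have g: "g x y = F (\<lambda>i. e * x i + idempotent q p * y i)" for x y
    unfolding g_def
  proof (rule F_cong)
    fix i assume "i < n"
    moreover have "[e * (x i mod int p) = e * x i] (mod int (p * q))"
      by (rule idempotent_cong) (simp add: cong_def)
    moreover have "[idempotent q p * (y i mod int q) = idempotent q p * y i] (mod int (q * p))"
      by (rule other.idempotent_cong) (simp add: cong_def)
    ultimately show "[e * (if i < n then x i mod int p else 0)
        + idempotent q p * (if i < n then y i mod int q else 0) = e * x i + idempotent q p * y i] (mod int (p * q))"
      by (simp add: cong_add mult.commute[of "int q"])
  qed
  have "(\<lambda>\<sigma> :: nat + nat \<Rightarrow> int. F (\<lambda>i. e * \<sigma> (Inl i) + idempotent q p * \<sigma> (Inr i))) \<in> clone_functions (p * q) C"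
    by (intro clone_functions_subst[OF F] clone_functions_add clone_functions_scale variable_in_clone_functions)
  then have "(\<lambda>x y. (\<Prod>u\<in>{}. x u) * g x y) \<in> prime_part p q C"
    by (simp add: prime_part_def g clone_functions_scale)
  moreover have "g x y = g (reduce {..<n} p x) (reduce {..<n} q y)" for x y
    by (simp add: g_def reduce_def cong: if_cong)
  ultimately have "(\<lambda>x y. (\<Prod>u\<in>{}. x u) * g x y) \<in> prime_part p q D"
    using n by (intro prime_part_subset[OF D slices, where X = "{..<n}"]) auto
  then have "(\<lambda>\<sigma> :: nat + nat \<Rightarrow> int. e * F (\<lambda>i. e * \<sigma> (Inl i) + idempotent q p * \<sigma> (Inr i))) \<in> clone_functions (p * q) D"
    by (simp add: prime_part_def g)
  from D.clone_functions_subst[OF this, of "\<lambda>v \<sigma>. \<sigma> (case v of Inl i \<Rightarrow> i | Inr i \<Rightarrow> i)"]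
  have "(\<lambda>\<sigma>. e * F (\<lambda>i. e * \<sigma> i + idempotent q p * \<sigma> i)) \<in> clone_functions (p * q) D"
    by (simp add: D.variable_in_clone_functions)
  moreover have "F (\<lambda>i. e * \<sigma> i + idempotent q p * \<sigma> i) = F \<sigma>" for \<sigma>
    by (rule F_cong) (use cong_scalar_right[OF idempotents_sum] in \<open>simp add: distrib_right[symmetric]\<close>)
  ultimately show ?thesis by (simp add: F_def)
qed

text \<open>
  An index \<open>d > p\<close> can be lowered by \<open>p - 1\<close> and still is at least 2, so periodicity is
  available in \<open>D\<close> for the way back.
\<close>

lemma all_slices_subset:
  assumes D: "D \<in> clones_above_add (p * q)"
    and slices: "\<And>d. d \<le> p \<Longrightarrow> slice p q C d \<subseteq> slice p q D d"
  shows "slice p q C d \<subseteq> slice p q D d"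
proof (induction d rule: less_induct)
  case (less d)
  interpret D: clone_at_prime p q D
    using p q p_neq_q D by unfold_locales
  show ?case
  proof (cases "d \<le> p")
    case False
    define d' where "d' = d - (p - 1)"
    have d': "d = d' + (p - 1)" "d' \<ge> 2" "d' < d" using False p_gt_1 by (auto simp: d'_def)
    have "slice p q C d \<subseteq> slice p q C d'" using slice_reduce[of d' 1] d' by simp
    also have "\<dots> \<subseteq> slice p q D d'" using d'(3) by (rule less.IH)
    also have "\<dots> \<subseteq> slice p q D d" using D.slice_raise[OF d'(2)] d'(1) by simp
    finally show ?thesis .
  qed (rule slices)
qed

lemma subset_if_slices_subset:
  assumes D: "D \<in> clones_above_add (p * q)"
    and slices_p: "\<And>d. d \<le> p \<Longrightarrow> slice p q C d \<subseteq> slice p q D d"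
    and slices_q: "\<And>d. d \<le> q \<Longrightarrow> slice q p C d \<subseteq> slice q p D d"
  shows "C \<subseteq> D"
proof clarify
  fix n f assume f: "(n, f) \<in> C"
  interpret other: clone_at_prime q p C by (rule other_prime)
  interpret D: clone_at_prime p q D
    using p q p_neq_q D by unfold_locales
  have D': "D \<in> clones_above_add (q * p)" using D by (simp add: mult.commute)
  let ?F = "\<lambda>\<sigma>. f (map (\<lambda>i. \<sigma> i mod int (p * q)) [0..<n])"
  have "(\<lambda>\<sigma>. e * ?F \<sigma>) \<in> clone_functions (p * q) D"
    using D all_slices_subset[OF D slices_p] f by (rule idempotent_operation_transfer)
  moreover have "(\<lambda>\<sigma>. idempotent q p * f (map (\<lambda>i. \<sigma> i mod int (q * p)) [0..<n])) \<in> clone_functions (q * p) D"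
    using D' other.all_slices_subset[OF D' slices_q] f by (rule other.idempotent_operation_transfer)
  then have "(\<lambda>\<sigma>. idempotent q p * ?F \<sigma>) \<in> clone_functions (p * q) D"
    by (simp only: mult.commute[of q p])
  ultimately have "(\<lambda>\<sigma>. e * ?F \<sigma> + idempotent q p * ?F \<sigma>) \<in> clone_functions (p * q) D"
    by (rule D.clone_functions_add)
  then have "?F \<in> clone_functions (p * q) D"
    by (rule D.clone_functions_cong)
      (use cong_scalar_right[OF idempotents_sum] in \<open>simp add: distrib_right[symmetric] cong_sym_eq\<close>)
  moreover have "f \<in> tuples n A \<rightarrow>\<^sub>E A" "n \<ge> 1"
    using f clone by (auto simp: is_clone_def finitary_functions_def)
  ultimately show "(n, f) \<in> D" by (intro D.operation_in_C)
qed

end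

section \<open>The injection\<close>

theorem theorem1p4:
  fixes p q :: nat
  assumes "prime p" and "prime q" and "p \<noteq> q"
  shows "\<exists>\<phi>. \<phi> \<in> clones_above_add (p * q) \<rightarrow>
                 ({..<p + 1} \<rightarrow>\<^sub>E clonoids p q) \<times> ({..<q + 1} \<rightarrow>\<^sub>E clonoids q p)
            \<and> inj_on \<phi> (clones_above_add (p * q))"
proof -
  define \<phi> where "\<phi> C = ((\<lambda>d\<in>{..<p + 1}. slice p q C d), (\<lambda>d\<in>{..<q + 1}. slice q p C d))" for C
  have at_p: "clone_at_prime p q C" if "C \<in> clones_above_add (p * q)" for C
    using assms that by unfold_locales
  have at_q: "clone_at_prime q p C" if "C \<in> clones_above_add (p * q)" for C
    by (rule clone_at_prime.other_prime[OF at_p[OF that]])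
  have "\<phi> \<in> clones_above_add (p * q) \<rightarrow>
      ({..<p + 1} \<rightarrow>\<^sub>E clonoids p q) \<times> ({..<q + 1} \<rightarrow>\<^sub>E clonoids q p)"
    using clone_at_prime.slice_clonoid[OF at_p] clone_at_prime.slice_clonoid[OF at_q]
    by (auto simp: \<phi>_def)
  moreover have "inj_on \<phi> (clones_above_add (p * q))"
  proof (rule inj_onI)
    fix C D assume C: "C \<in> clones_above_add (p * q)" and D: "D \<in> clones_above_add (p * q)"
      and eq: "\<phi> C = \<phi> D"
    have "slice p q C d = slice p q D d" if "d \<le> p" for d
      using fun_cong[OF arg_cong[OF eq, of fst], of d] that by (simp add: \<phi>_def)
    moreover have "slice q p C d = slice q p D d" if "d \<le> q" for d
      using fun_cong[OF arg_cong[OF eq, of snd], of d] that by (simp add: \<phi>_def)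
    ultimately show "C = D"
      using clone_at_prime.subset_if_slices_subset[OF at_p[OF C] D]
        clone_at_prime.subset_if_slices_subset[OF at_p[OF D] C] by blast
  qed
  ultimately show ?thesis by blast
qed

end
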